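(* Let $L$ be a Scott locale. Then its spectrum $\Sigma(L)$ is a $T_1$ space.
   Context: A locale is a complete lattice $L$ in which finite meets distribute over arbitrary joins (a frame), with top $1$ and bottom $0$. An element $x \in L$ is prime if $x \neq 1$ and, for all $a,b\in L$, $a \wedge b \leq x$ implies $a \leq x$ or $b \leq x$. The spectrum $\Sigma(L)$ is the set of prime elements of $L$, with the topology whose open sets are exactly the sets $\mathcal{U}_a = \{x \in \Sigma(L) \mid a \nleq x\}$ for $a \in L$. The Scott topology on $L$ has as open sets the upward closed subsets $\mathcal{U} \subseteq L$ such that for every directed (nonempty) subset $D \subseteq L$ with $\bigvee D \in \mathcal{U}$ one has $D \cap \mathcal{U} \neq \emptyset$. The locale $L$ is called a Scott locale if the inclusion map $p: \Sigma(L) \to L$ is continuous when $\Sigma(L)$ carries the topology above and $L$ carries the Scott topology. *)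

theory Defs
  imports "HOL-Analysis.Analysis"
begin

text \<open>
  A locale (as a lattice) is a frame. Only the finite-meet/arbitrary-join law is required;
  the library class \<open>complete_distrib_lattice\<close> is complete distributivity, which is stronger.
  The degenerate frame with \<open>bot = top\<close> is allowed.
\<close>

class frame = complete_lattice +
  assumes inf_Sup_distrib: "inf a (Sup B) = Sup (inf a ` B)"

definition meet_prime :: "'a::frame \<Rightarrow> bool" where
  "meet_prime x \<longleftrightarrow> x \<noteq> top \<and> (\<forall>a b. inf a b \<le> x \<longrightarrow> a \<le> x \<or> b \<le> x)"

definition spectrum :: "'a::frame set" where
  "spectrum = {x. meet_prime x}"

definition spectrum_open :: "'a::frame \<Rightarrow> 'a set" where
  "spectrum_open a = {x \<in> spectrum. \<not> a \<le> x}"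

definition spectrum_topology :: "'a::frame topology" where
  "spectrum_topology = topology (\<lambda>U. \<exists>a. U = spectrum_open a)"

definition directed_set :: "'a::order set \<Rightarrow> bool" where
  "directed_set D \<longleftrightarrow> D \<noteq> {} \<and> (\<forall>x\<in>D. \<forall>y\<in>D. \<exists>z\<in>D. x \<le> z \<and> y \<le> z)"

definition scott_open :: "'a::complete_lattice set \<Rightarrow> bool" where
  "scott_open U \<longleftrightarrow> (\<forall>x\<in>U. \<forall>y. x \<le> y \<longrightarrow> y \<in> U) \<and>
     (\<forall>D. directed_set D \<and> Sup D \<in> U \<longrightarrow> D \<inter> U \<noteq> {})"

definition scott_topology :: "'a::complete_lattice topology" where
  "scott_topology = topology scott_open"

text \<open>The inclusion of the spectrum is \<open>\<lambda>x. x\<close>, since the spectrum is a subset of the frame.\<close>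

definition scott_locale :: "'a::frame itself \<Rightarrow> bool" where
  "scott_locale _ \<longleftrightarrow>
     continuous_map (spectrum_topology :: 'a topology) (scott_topology :: 'a topology) (\<lambda>x. x)"

text \<open>
  \<^const>\<open>topology\<close> is meaningful only for predicates satisfying \<^const>\<open>istopology\<close>; the lemmas
  below establish that the two topologies have exactly the intended open sets.
\<close>

lemma spectrum_open_inf: "spectrum_open (inf a b) = spectrum_open a \<inter> spectrum_open b"
  by (auto simp: spectrum_open_def spectrum_def meet_prime_def intro: le_infI1 le_infI2)

lemma spectrum_open_Sup: "spectrum_open (Sup A) = (\<Union>a\<in>A. spectrum_open a)"
  by (auto simp: spectrum_open_def Sup_le_iff)

lemma openin_spectrum_topology: "openin spectrum_topology U \<longleftrightarrow> (\<exists>a. U = spectrum_open a)"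
proof -
  have "istopology (\<lambda>U. \<exists>a::'a. U = spectrum_open a)"
    unfolding istopology_def
  proof (intro conjI allI impI)
    fix S T :: "'a set"
    assume "\<exists>a. S = spectrum_open a" "\<exists>a. T = spectrum_open a"
    then show "\<exists>a. S \<inter> T = spectrum_open a" by (metis spectrum_open_inf)
  next
    fix K :: "'a set set"
    assume "\<forall>U\<in>K. \<exists>a. U = spectrum_open a"
    then obtain f where "\<And>U. U \<in> K \<Longrightarrow> U = spectrum_open (f U)"
      by metis
    then have "\<Union>K = (\<Union>a\<in>f ` K. spectrum_open a)"
      by simp
    then show "\<exists>a. \<Union>K = spectrum_open a" by (metis spectrum_open_Sup)
  qed
  then show ?thesis by (simp add: spectrum_topology_def)
qed

lemma topspace_spectrum_topology: "topspace spectrum_topology = (spectrum :: 'a::frame set)"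
proof -
  have "spectrum_open top = (spectrum :: 'a set)"
    by (auto simp: spectrum_open_def spectrum_def meet_prime_def top_unique)
  then have "openin spectrum_topology (spectrum :: 'a set)"
    by (metis openin_spectrum_topology)
  moreover have "topspace spectrum_topology \<subseteq> (spectrum :: 'a set)"
    by (auto simp: topspace_def openin_spectrum_topology spectrum_open_def)
  ultimately show ?thesis by (simp add: openin_subset subset_antisym)
qed

lemma scott_openI:
  assumes "\<And>D. directed_set D \<Longrightarrow> Sup D \<in> U \<Longrightarrow> D \<inter> U \<noteq> {}"
    and "\<And>x y. x \<in> U \<Longrightarrow> x \<le> y \<Longrightarrow> y \<in> U"
  shows "scott_open U"
  using assms by (auto simp: scott_open_def)

lemma openin_scott_topology: "openin scott_topology U \<longleftrightarrow> scott_open U"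
proof -
  have "istopology (scott_open :: 'a set \<Rightarrow> bool)"
    unfolding istopology_def
  proof (intro conjI allI impI)
    fix S T :: "'a set"
    assume S: "scott_open S" and T: "scott_open T"
    have "D \<inter> (S \<inter> T) \<noteq> {}" if D: "directed_set D" and "Sup D \<in> S \<inter> T" for D
    proof -
      have "D \<inter> S \<noteq> {}" "D \<inter> T \<noteq> {}"
        using S T that by (simp_all add: scott_open_def)
      then obtain s t where st: "s \<in> D" "s \<in> S" "t \<in> D" "t \<in> T"
        by blast
      then obtain z where z: "z \<in> D" "s \<le> z" "t \<le> z"
        using D unfolding directed_set_def by blast
      have "z \<in> S" "z \<in> T"
        using S T st z unfolding scott_open_def by metis+
      then show ?thesis using z(1) by blast
    qed
    moreover have "y \<in> S \<inter> T" if "x \<in> S \<inter> T" "x \<le> y" for x y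
      using S T that unfolding scott_open_def by (metis IntE IntI)
    ultimately show "scott_open (S \<inter> T)" by (intro scott_openI)
  next
    fix K :: "'a set set"
    assume K: "\<forall>U\<in>K. scott_open U"
    have "D \<inter> \<Union>K \<noteq> {}" if D: "directed_set D" and sup: "Sup D \<in> \<Union>K" for D
    proof -
      obtain U where "U \<in> K" "Sup D \<in> U" using sup by blast
      moreover from this have "D \<inter> U \<noteq> {}"
        using K D by (simp add: scott_open_def)
      ultimately show ?thesis by blast
    qed
    moreover have "y \<in> \<Union>K" if "x \<in> \<Union>K" "x \<le> y" for x y
    proof -
      obtain U where "U \<in> K" "x \<in> U" using \<open>x \<in> \<Union>K\<close> by blast
      moreover from this have "y \<in> U"
        using K \<open>x \<le> y\<close> by (auto simp: scott_open_def)
      ultimately show ?thesis by blast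
    qed
    ultimately show "scott_open (\<Union>K)" by (intro scott_openI)
  qed
  then show ?thesis by (simp add: scott_topology_def)
qed

lemma topspace_scott_topology: "topspace scott_topology = (UNIV :: 'a::complete_lattice set)"
proof -
  have "openin scott_topology (UNIV :: 'a set)"
    by (auto simp: openin_scott_topology scott_open_def directed_set_def)
  then show ?thesis using openin_subset top.extremum_uniqueI by metis
qed

end

theory Submission
  imports Defs
begin

text \<open>
  The complement of a principal ideal is Scott open, hence has an upward closed trace on the
  spectrum; but the spectral open sets are downward closed. So comparable primes are equal, and
  the closure of a prime \<open>y\<close>, which consists of the primes above \<open>y\<close>, is \<open>{y}\<close>.
\<close>

text \<open>If \<open>x\<close> bounds every member of \<open>D\<close>, it bounds
  \<open>Sup D\<close>; so when \<open>Sup D\<close> is not below \<open>x\<close>, some member is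
  not either.\<close>

lemma scott_open_not_le: "scott_open {z :: 'a::complete_lattice. \<not> z \<le> x}"
  by (rule scott_openI) (auto simp: Sup_le_iff intro: order_trans)

lemma scott_locale_spectrum_antichain:
  fixes x y :: "'a::frame"
  assumes "scott_locale TYPE('a)" "x \<in> spectrum" "y \<in> spectrum" "x \<le> y"
  shows "x = y"
proof -
  have "openin spectrum_topology {z \<in> topspace spectrum_topology. z \<in> {z :: 'a. \<not> z \<le> x}}"
    using assms(1) unfolding scott_locale_def
    by (rule openin_continuous_map_preimage) (simp add: openin_scott_topology scott_open_not_le)
  then obtain a where "{z \<in> spectrum. \<not> z \<le> x} = spectrum_open a"
    by (auto simp: openin_spectrum_topology topspace_spectrum_topology)
  \<comment> \<open>Complementing both sides: among primes, lying below \<open>x\<close> is the same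
    as lying above \<open>a\<close>, a condition that passes upward from \<open>x\<close> to
    \<open>y\<close>.\<close>
  then have a: "z \<le> x \<longleftrightarrow> a \<le> z" if "z \<in> spectrum" for z
    using that by (auto simp: spectrum_open_def)
  have "a \<le> x" using a assms(2) by blast
  then have "a \<le> y" using assms(4) by (rule order_trans)
  then have "y \<le> x" using a assms(3) by blast
  with assms(4) show ?thesis by (rule antisym)
qed

theorem lemma4p1:
  assumes "scott_locale TYPE('a::frame)"
  shows "t1_space (spectrum_topology :: 'a topology)"
  unfolding t1_space_def topspace_spectrum_topology
proof (intro ballI impI)
  fix x y :: 'a
  assume xy: "x \<in> spectrum" "y \<in> spectrum" "x \<noteq> y"
  then have "\<not> y \<le> x"
    using scott_locale_spectrum_antichain[OF assms] by blast
  \<comment> \<open>The largest open set avoiding \<open>y\<close>: \<open>spectrum_open a\<close>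
    misses the prime \<open>y\<close> exactly when \<open>a \<le> y\<close>.\<close>
  then have "x \<in> spectrum_open y" "y \<notin> spectrum_open y"
    using xy by (simp_all add: spectrum_open_def)
  moreover have "openin spectrum_topology (spectrum_open y)"
    by (auto simp: openin_spectrum_topology)
  ultimately show "\<exists>U. openin spectrum_topology U \<and> x \<in> U \<and> y \<notin> U"
    by blast
qed

end
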